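(* Let $m\geq 2$ be an integer and let $n$ be the number of distinct prime divisors of $m$. If $\mathrm{ZT}(\mathbb{Z}_m)$ is a connected graph, then its domination number is $\gamma(\mathrm{ZT}(\mathbb{Z}_m))=n$.
   Context: $\mathbb{Z}_m$ is the ring of integers modulo $m$, and $Z(\mathbb{Z}_m)$ is its set of zero-divisors, with $0$ included. The total zero-divisor graph $\mathrm{ZT}(\mathbb{Z}_m)$ is the simple graph whose vertices are the nonzero zero-divisors of $\mathbb{Z}_m$, with distinct vertices $u,v$ adjacent if and only if $uv=0$ and $u+v\in Z(\mathbb{Z}_m)$. A connected graph has at least one vertex. A dominating set of a graph $G$ is a subset $D$ of the vertex set such that every vertex not in $D$ is adjacent to at least one member of $D$; the domination number $\gamma(G)$ is the smallest size of a dominating set. *)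

theory Defs
  imports
    "HOL-Number_Theory.Residues"
    "Graph_Theory.Digraph_Component"
begin

text \<open>
  For commutative \<open>R\<close>. Here \<open>\<zero>\<close> counts as a zero-divisor, provided that \<open>R\<close> is not the
  zero ring.
\<close>
definition zero_divisors :: "('a, 'b) ring_scheme \<Rightarrow> 'a set" where
  "zero_divisors R = {a \<in> carrier R. \<exists>b \<in> carrier R. b \<noteq> \<zero>\<^bsub>R\<^esub> \<and> a \<otimes>\<^bsub>R\<^esub> b = \<zero>\<^bsub>R\<^esub>}"

lemma zero_in_zero_divisors:
  assumes "cring R" "\<one>\<^bsub>R\<^esub> \<noteq> \<zero>\<^bsub>R\<^esub>"
  shows "\<zero>\<^bsub>R\<^esub> \<in> zero_divisors R"
proof -
  interpret cring R by fact
  show ?thesis using assms(2) by (auto simp: zero_divisors_def)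
qed

text \<open>
  A simple undirected graph is represented by a symmetric, loop-free set of arcs.
\<close>
definition total_zero_divisor_graph :: "('a, 'b) ring_scheme \<Rightarrow> 'a pair_pre_digraph" where
  "total_zero_divisor_graph R =
     \<lparr> pverts = zero_divisors R - {\<zero>\<^bsub>R\<^esub>},
       parcs = {(u, v). u \<in> zero_divisors R - {\<zero>\<^bsub>R\<^esub>} \<and> v \<in> zero_divisors R - {\<zero>\<^bsub>R\<^esub>} \<and>
                        u \<noteq> v \<and> u \<otimes>\<^bsub>R\<^esub> v = \<zero>\<^bsub>R\<^esub> \<and> u \<oplus>\<^bsub>R\<^esub> v \<in> zero_divisors R} \<rparr>"

lemma pair_graph_total_zero_divisor_graph:
  assumes "cring R" "finite (carrier R)"
  shows "pair_graph (total_zero_divisor_graph R)"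
proof -
  interpret cring R by fact
  have sub: "zero_divisors R \<subseteq> carrier R"
    by (auto simp: zero_divisors_def)
  then have fin: "finite (zero_divisors R)"
    using assms(2) by (rule finite_subset)
  have "parcs (total_zero_divisor_graph R) \<subseteq> zero_divisors R \<times> zero_divisors R"
    by (auto simp: total_zero_divisor_graph_def)
  then have "finite (parcs (total_zero_divisor_graph R))"
    by (rule finite_subset) (simp add: fin)
  moreover have "sym (parcs (total_zero_divisor_graph R))"
    using sub by (auto simp: total_zero_divisor_graph_def sym_def m_comm a_comm subset_iff)
  ultimately show ?thesis
    using fin by unfold_locales
      (auto simp: total_zero_divisor_graph_def symmetric_def)
qed

definition dominating_set :: "('a, 'b) pre_digraph \<Rightarrow> 'a set \<Rightarrow> bool" where
  "dominating_set G D \<longleftrightarrow> D \<subseteq> verts G \<and> (\<forall>v \<in> verts G - D. \<exists>u \<in> D. v \<rightarrow>\<^bsub>G\<^esub> u)"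

text \<open>
  Only finite dominating sets compete, since \<^const>\<open>card\<close> is \<open>0\<close> on infinite sets. A finite
  graph has at least one, namely its whole vertex set.
\<close>
definition domination_number :: "('a, 'b) pre_digraph \<Rightarrow> nat" where
  "domination_number G = (LEAST k. \<exists>D. finite D \<and> dominating_set G D \<and> card D = k)"

end

theory Submission
  imports Defs
begin

text \<open>
  Let \<open>p\<close> range over the prime divisors of \<open>m\<close>. Everything rests on the observation that the
  neighbours of the vertex \<open>p\<close> are multiples of \<open>m / p\<close>.

  If \<open>p\<close> divides \<open>m\<close> exactly once, then the vertex \<open>p\<close> has no neighbour: for a nonzero multiple
  \<open>v\<close> of \<open>m / p\<close>, the sum \<open>p + v\<close> is divisible neither by \<open>p\<close> (which does not divide \<open>v\<close>) nor by
  another prime divisor of \<open>m\<close> (which divides \<open>v\<close> but not \<open>p\<close>). In a connected graph that is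
  impossible, since \<open>m / p\<close> is a second vertex; and for prime \<open>m\<close> the graph is empty. So
  connectedness forces \<open>p\<^sup>2\<close> to divide \<open>m\<close> for every \<open>p\<close> (\<open>connected_imp_prime_square_dvd\<close>).

  Assume this from now on. The residues \<open>m / p\<close> form a dominating set: a vertex divisible by \<open>p\<close>
  annihilates \<open>m / p\<close>, and the sum of the two is again divisible by \<open>p\<close>, because \<open>p\<close> divides
  \<open>m / p\<close> (\<open>dominating_set_cofactors\<close>). Conversely, a dominating set must contain, for every
  \<open>p\<close>, the vertex \<open>p\<close> or a nonzero multiple of \<open>m / p\<close>. An element cannot serve two primes
  \<open>p\<close> and \<open>q\<close>: a common multiple of \<open>m / p\<close> and \<open>m / q\<close> is a multiple of \<open>m\<close>, and \<open>p\<close> is not a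
  multiple of \<open>m / q\<close> since \<open>q\<close> divides the latter (\<open>card_prime_factors_le_dominating_set\<close>).
\<close>

section \<open>Zero-divisors and adjacency modulo m\<close>

lemma mem_zero_divisors_residue_ring_iff:
  fixes m :: nat
  assumes "m \<ge> 2"
  shows "a \<in> zero_divisors (residue_ring (int m)) \<longleftrightarrow>
    0 \<le> a \<and> a < int m \<and> (\<exists>p \<in> prime_factors m. int p dvd a)"
proof
  assume a: "a \<in> zero_divisors (residue_ring (int m))"
  then obtain b where ab: "0 \<le> a" "a < int m" "0 < b" "b < int m" "int m dvd a * b"
    by (force simp: zero_divisors_def residue_ring_def)
  have "\<not> coprime (int m) a"
  proof
    assume "coprime (int m) a"
    then have "int m dvd b"
      using ab(5) by (simp add: coprime_dvd_mult_right_iff)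
    then show False
      using ab zdvd_imp_le by force
  qed
  then have "gcd m (nat a) \<noteq> 1"
    using ab(1) by (metis coprime_iff_gcd_eq_1 coprime_int_iff int_nat_eq)
  then obtain p where p: "prime p" "p dvd gcd m (nat a)"
    using prime_factor_nat by blast
  then have "int p dvd a"
    using ab(1) by (metis gcd_nat.boundedE int_dvd_int_iff int_nat_eq)
  then show "0 \<le> a \<and> a < int m \<and> (\<exists>p \<in> prime_factors m. int p dvd a)"
    using ab p assms by (auto simp: in_prime_factors_iff)
next
  assume a: "0 \<le> a \<and> a < int m \<and> (\<exists>p \<in> prime_factors m. int p dvd a)"
  then obtain p k where p: "prime p" "a = int p * k" "p dvd m"
    unfolding in_prime_factors_iff dvd_def by blast
  then obtain t where t: "m = p * t" by blast
  have "t > 0" "t < m"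
    using t assms p(1) prime_gt_1_nat[OF p(1)] by (auto intro: gr0I)
  then show "a \<in> zero_divisors (residue_ring (int m))"
    using a p t by (auto simp: zero_divisors_def residue_ring_def intro!: bexI[of _ "int t"])
qed

lemma verts_total_zero_divisor_graph_residue_ring_iff:
  fixes m :: nat
  assumes "m \<ge> 2"
  shows "a \<in> verts (with_proj (total_zero_divisor_graph (residue_ring (int m)))) \<longleftrightarrow>
    0 < a \<and> a < int m \<and> (\<exists>p \<in> prime_factors m. int p dvd a)"
  using mem_zero_divisors_residue_ring_iff[OF assms, of a]
  by (auto simp: total_zero_divisor_graph_def) (auto simp: residue_ring_def)

lemma adj_total_zero_divisor_graph_residue_ring_iff:
  fixes m :: nat
  assumes "m \<ge> 2"
  defines "G \<equiv> with_proj (total_zero_divisor_graph (residue_ring (int m)))"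
  shows "u \<rightarrow>\<^bsub>G\<^esub> v \<longleftrightarrow> u \<in> verts G \<and> v \<in> verts G \<and> u \<noteq> v \<and> int m dvd u * v \<and>
    (\<exists>p \<in> prime_factors m. int p dvd u + v)"
proof -
  have "(u + v) mod int m \<in> zero_divisors (residue_ring (int m)) \<longleftrightarrow>
      (\<exists>p \<in> prime_factors m. int p dvd u + v)"
    using assms(1)
    by (auto simp: mem_zero_divisors_residue_ring_iff dvd_mod_iff in_prime_factors_iff)
  then show ?thesis
    by (auto simp: G_def arcs_ends_def arc_to_ends_def total_zero_divisor_graph_def)
       (auto simp: residue_ring_def)
qed

section \<open>Connectedness forces squares of primes\<close>

text \<open>
  Write \<open>m = p t\<close>. A neighbour is \<open>v = t c\<close> with \<open>c\<close> not divisible by \<open>p\<close>, as \<open>v\<close> is nonzero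
  modulo \<open>m\<close>. The prime that witnesses that \<open>p + v\<close> is a zero-divisor must be \<open>p\<close>: any other
  one divides \<open>t\<close>, hence \<open>v\<close>, hence \<open>p\<close>. So \<open>p\<close> divides \<open>t c\<close>, and therefore \<open>t\<close>.
\<close>
lemma prime_square_dvd_if_adj:
  fixes m p :: nat
  assumes m: "m \<ge> 2" and p: "prime p" "p dvd m"
    and adj: "int p \<rightarrow>\<^bsub>with_proj (total_zero_divisor_graph (residue_ring (int m)))\<^esub> v"
  shows "p\<^sup>2 dvd m"
proof -
  obtain t where t: "m = p * t" using p(2) by blast
  have p0: "int p \<noteq> 0" using p(1) by (simp add: prime_gt_0_nat)
  note adj' = adj[unfolded adj_total_zero_divisor_graph_residue_ring_iff[OF m]
      verts_total_zero_divisor_graph_residue_ring_iff[OF m]]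
  have v: "0 < v" "v < int m" "int m dvd int p * v"
    using adj' by blast+
  obtain q where q: "prime q" "q dvd m" "int q dvd int p + v"
    using adj' by (auto simp: in_prime_factors_iff)
  have tv: "int t dvd v" using v(3) p0 t by simp
  then obtain c where c: "v = int t * c" by blast
  have "q = p"
  proof (rule ccontr)
    assume "q \<noteq> p"
    then have "\<not> q dvd p" using p(1) q(1) primes_dvd_imp_eq by blast
    then have "q dvd t" using q t by (simp add: prime_dvd_mult_iff)
    then have "int q dvd v" using tv by (meson dvd_trans int_dvd_int_iff)
    then have "int q dvd int p" using q(3) by (simp add: dvd_add_left_iff)
    with \<open>\<not> q dvd p\<close> show False by simp
  qed
  then have "int p dvd int t * c" using q(3) c by simp
  moreover have "\<not> int p dvd c"
  proof
    assume "int p dvd c"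
    then have "int m dvd v" using c t by (auto simp: mult.commute)
    then show False using v zdvd_imp_le by force
  qed
  ultimately have "p dvd t" using p(1) by (auto simp: prime_dvd_mult_iff)
  then show ?thesis using t by (simp add: power2_eq_square)
qed

text \<open>
  A neighbour of \<open>p\<close> is supplied by a walk from \<open>p\<close> to \<open>m / p\<close>; when these two vertices
  coincide, \<open>m\<close> is the square of \<open>p\<close>.
\<close>
lemma connected_imp_prime_square_dvd:
  fixes m p :: nat
  defines "G \<equiv> with_proj (total_zero_divisor_graph (residue_ring (int m)))"
  assumes m: "m \<ge> 2" and conn: "Digraph_Component.connected G" and p: "prime p" "p dvd m"
  shows "p\<^sup>2 dvd m"
proof -
  have R: "residues (int m)" using m by unfold_locales simp
  have "pair_graph (total_zero_divisor_graph (residue_ring (int m)))"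
    by (intro pair_graph_total_zero_divisor_graph residues.cring[OF R])
       (simp add: residue_ring_def)
  then interpret pair_graph "total_zero_divisor_graph (residue_ring (int m))" .
  have sc: "strongly_connected G"
    using conn unfolding G_def
    by (intro symmetric_connected_imp_strongly_connected sym_arcs)
  note verts_iff = verts_total_zero_divisor_graph_residue_ring_iff[OF m, folded G_def]
  obtain t where t: "m = p * t" using p(2) by blast
  \<comment> \<open>For prime \<open>m\<close> the graph is empty.\<close>
  have "p \<noteq> m"
  proof
    assume "p = m"
    obtain w where "w \<in> verts G" using sc by (auto simp: strongly_connected_def)
    then have "0 < w" "w < int m" "int m dvd w"
      using p(1) \<open>p = m\<close> by (auto simp: verts_iff prime_prime_factors)
    then show False using zdvd_imp_le by force
  qed
  then have "p < m" "t > 1" "t < m"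
    using t m p(1) prime_gt_1_nat[OF p(1)] by (auto simp: nat_neq_iff)
  then have pV: "int p \<in> verts G"
    using p m by (auto simp: verts_iff in_prime_factors_iff intro!: bexI[of _ p] prime_gt_0_nat)
  obtain q where "prime q" "q dvd t" using \<open>t > 1\<close> prime_factor_nat[of t] by auto
  then have tV: "int t \<in> verts G"
    using t \<open>t > 1\<close> \<open>t < m\<close> m
    by (auto simp: verts_iff in_prime_factors_iff intro!: bexI[of _ q])
  show ?thesis
  proof (cases "t = p")
    case True
    then show ?thesis using t by (simp add: power2_eq_square)
  next
    case False
    have "int p \<rightarrow>\<^sup>*\<^bsub>G\<^esub> int t" using sc pV tV by (auto simp: strongly_connected_def)
    then obtain v where "int p \<rightarrow>\<^bsub>G\<^esub> v"
      using False by (cases rule: pre_digraph.converse_reachable_cases) auto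
    then show ?thesis using prime_square_dvd_if_adj[OF m p] by (simp add: G_def)
  qed
qed

section \<open>Dominating sets\<close>

lemma inj_on_cofactor:
  fixes m :: nat
  assumes "m \<noteq> 0"
  shows "inj_on (\<lambda>p. int (m div p)) (prime_factors m)"
proof (rule inj_onI)
  fix p q assume pq: "p \<in> prime_factors m" "q \<in> prime_factors m" "int (m div p) = int (m div q)"
  then have "p * (m div p) = q * (m div p)"
    by (metis dvd_mult_div_cancel in_prime_factors_imp_dvd of_nat_eq_iff)
  moreover have "m div p \<noteq> 0"
    using pq(1) assms by (metis dvd_mult_div_cancel in_prime_factors_imp_dvd mult_0_right)
  ultimately show "p = q" by simp
qed

text \<open>
  The hypothesis on squares gives \<open>p\<close> dividing \<open>m div p\<close>, so that for a vertex \<open>v\<close> divisible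
  by \<open>p\<close> both summands of \<open>v + m div p\<close> are multiples of \<open>p\<close>.
\<close>
lemma dominating_set_cofactors:
  fixes m :: nat
  assumes m: "m \<ge> 2" and sq: "\<And>p. prime p \<Longrightarrow> p dvd m \<Longrightarrow> p\<^sup>2 dvd m"
  shows "dominating_set (with_proj (total_zero_divisor_graph (residue_ring (int m))))
    ((\<lambda>p. int (m div p)) ` prime_factors m)" (is "dominating_set ?G ?D")
proof -
  note verts_iff = verts_total_zero_divisor_graph_residue_ring_iff[OF m]
  note adj_iff = adj_total_zero_divisor_graph_residue_ring_iff[OF m]
  have cofactor: "p * (m div p) = m" "p dvd m div p" "0 < m div p" "m div p < m"
    if "p \<in> prime_factors m" for p
  proof -
    have p: "prime p" "p dvd m" using that by (auto simp: in_prime_factors_iff)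
    then show "p * (m div p) = m" by simp
    obtain k where "m = p\<^sup>2 * k" using sq[OF p] by blast
    then show "p dvd m div p" using p(1) by (simp add: power2_eq_square mult.assoc)
    show "0 < m div p" using m p by (simp add: dvd_imp_le div_greater_zero_iff prime_gt_0_nat)
    show "m div p < m" using m prime_gt_1_nat[OF p(1)] by simp
  qed
  have DV: "int (m div p) \<in> verts ?G" if "p \<in> prime_factors m" for p
    unfolding verts_iff using cofactor[OF that] that by (auto simp del: of_nat_div intro!: bexI[of _ p])
  show ?thesis
    unfolding dominating_set_def
  proof (intro conjI ballI)
    show "?D \<subseteq> verts ?G" using DV by blast
    fix v assume v: "v \<in> verts ?G - ?D"
    then obtain p where p: "p \<in> prime_factors m" "int p dvd v"
      unfolding Diff_iff verts_iff by blast
    have "int m dvd v * int (m div p)"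
      using p(2) cofactor(1)[OF p(1)]
      by (metis dvd_refl mult_dvd_mono of_nat_mult)
    moreover have "int p dvd v + int (m div p)"
      using p(2) cofactor(2)[OF p(1)] by (intro dvd_add) (simp_all only: int_dvd_int_iff)
    ultimately have "v \<rightarrow>\<^bsub>?G\<^esub> int (m div p)"
      using v p(1) DV[OF p(1)] unfolding adj_iff by blast
    then show "\<exists>u \<in> ?D. v \<rightarrow>\<^bsub>?G\<^esub> u" using p(1) by blast
  qed
qed

text \<open>
  The vertices \<open>p\<close>, for the prime divisors of \<open>m\<close>, have pairwise disjoint closed neighbourhoods,
  and a dominating set meets each of them.
\<close>
lemma card_prime_factors_le_dominating_set:
  fixes m :: nat
  assumes m: "m \<ge> 2" and sq: "\<And>p. prime p \<Longrightarrow> p dvd m \<Longrightarrow> p\<^sup>2 dvd m"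
    and D: "dominating_set (with_proj (total_zero_divisor_graph (residue_ring (int m)))) D"
      (is "dominating_set ?G D")
    and fin: "finite D"
  shows "card (prime_factors m) \<le> card D"
proof -
  note verts_iff = verts_total_zero_divisor_graph_residue_ring_iff[OF m]
  note adj_iff = adj_total_zero_divisor_graph_residue_ring_iff[OF m]
  \<comment> \<open>\<open>R p\<close> contains the closed neighbourhood of the vertex \<open>p\<close>; forgetting the condition on the
    sum keeps these sets disjoint on nonzero residues.\<close>
  define R where "R p x \<longleftrightarrow> x = int p \<or> int m dvd int p * x" for p :: nat and x
  have ex: "\<exists>x. x \<in> D \<and> R p x" if "p \<in> prime_factors m" for p
  proof -
    have p: "prime p" "p dvd m" using that by (auto simp: in_prime_factors_iff)
    have "p < p\<^sup>2" using prime_gt_1_nat[OF p(1)] by (simp add: power2_eq_square)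
    also have "p\<^sup>2 \<le> m" using sq[OF p] m by (simp add: dvd_imp_le)
    finally have "int p \<in> verts ?G"
      unfolding verts_iff using that prime_gt_0_nat[OF p(1)] by (auto intro!: bexI[of _ p])
    then have "int p \<in> D \<or> (\<exists>u \<in> D. int p \<rightarrow>\<^bsub>?G\<^esub> u)"
      using D by (auto simp: dominating_set_def)
    then show ?thesis unfolding R_def adj_iff by blast
  qed
  then obtain f where f: "f p \<in> D \<and> R p (f p)" if "p \<in> prime_factors m" for p by metis
  \<comment> \<open>If \<open>r\<close> is a prime other than \<open>q\<close>, this excludes that \<open>q\<close> annihilates the vertex \<open>r\<close>.\<close>
  have dvd_square: "q dvd r" if "prime q" "q dvd m" "int m dvd int q * int r" for q r :: nat
  proof -
    have "q * q dvd q * r"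
      using sq[OF that(1,2)] that(3)
      by (metis dvd_trans int_dvd_int_iff of_nat_mult power2_eq_square)
    then show ?thesis using prime_gt_0_nat[OF that(1)] by simp
  qed
  have unique: "p = q"
    if pq: "p \<in> prime_factors m" "q \<in> prime_factors m" and x: "x \<in> D" "R p x" "R q x" for p q x
  proof (rule ccontr)
    assume "p \<noteq> q"
    have p: "prime p" "p dvd m" and q: "prime q" "q dvd m"
      using pq by (auto simp: in_prime_factors_iff)
    have ndvd: "\<not> p dvd q" "\<not> q dvd p"
      using p q \<open>p \<noteq> q\<close> primes_dvd_imp_eq by blast+
    have "0 < x" "x < int m"
      using D x(1) by (auto simp: dominating_set_def verts_iff simp del: with_proj_simps)
    then have "\<not> int m dvd x" using zdvd_imp_le by force
    \<comment> \<open>If \<open>x\<close> is annihilated by both \<open>p\<close> and \<open>q\<close>, it is annihilated by \<open>1\<close>.\<close>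
    moreover have "coprime (int p) (int q)" using p q \<open>p \<noteq> q\<close> by (simp add: primes_coprime)
    then have "int m dvd x" if "int m dvd int p * x" "int m dvd int q * x"
    proof -
      obtain a b where "a * int p + b * int q = 1"
        using \<open>coprime (int p) (int q)\<close> bezout_int[of "int p" "int q"] by auto
      then have "x = a * (int p * x) + b * (int q * x)"
        by (metis distrib_right mult.assoc mult_1)
      then show ?thesis using that by (metis dvd_add dvd_mult)
    qed
    ultimately show False
      using x(2,3) ndvd \<open>p \<noteq> q\<close> dvd_square[OF p] dvd_square[OF q] unfolding R_def by auto
  qed
  have "inj_on f (prime_factors m)"
  proof (rule inj_onI)
    fix p q assume "p \<in> prime_factors m" "q \<in> prime_factors m" "f p = f q"
    then show "p = q" using unique[of p q "f p"] f[of p] f[of q] by simp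
  qed
  then show ?thesis
    using f fin by (intro card_inj_on_le[of f]) auto
qed

theorem proposition4p4:
  fixes m n :: nat
  assumes "m \<ge> 2"
    and "n = card (prime_factors m)"
    and "Digraph_Component.connected
           (with_proj (total_zero_divisor_graph (residue_ring (int m))))"
  shows "domination_number (with_proj (total_zero_divisor_graph (residue_ring (int m)))) = n"
proof -
  have sq: "p\<^sup>2 dvd m" if "prime p" "p dvd m" for p
    using connected_imp_prime_square_dvd[OF assms(1,3) that] .
  have "card ((\<lambda>p. int (m div p)) ` prime_factors m) = n"
    using assms(1,2) inj_on_cofactor[of m] by (subst card_image) auto
  moreover have "dominating_set (with_proj (total_zero_divisor_graph (residue_ring (int m))))
      ((\<lambda>p. int (m div p)) ` prime_factors m)"
    using dominating_set_cofactors[OF assms(1) sq] .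
  ultimately show ?thesis
    unfolding domination_number_def
    using card_prime_factors_le_dominating_set[OF assms(1) sq] assms(2)
    by (intro Least_equality) (blast intro: finite_imageI, auto)
qed

end
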